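(* Let $G=K_n-\{e\}$ be the graph obtained from the complete graph $K_n$ by deleting a single edge $e$. Any list $\Lambda=\{\lambda_1,\lambda_2,\ldots,\lambda_n\}$ of real numbers with at least three distinct elements is the spectrum of a matrix $M\in\mathcal{S}(G)$. Moreover, when $n=3$, a list $\Lambda=\{\lambda_1,\lambda_2,\lambda_3\}$ of three real numbers is the spectrum of some matrix $M\in\mathcal{S}(G)$ if and only if $\Lambda$ has exactly three distinct elements.
   Context: For a simple undirected graph $G$ with vertex set $\{1,\ldots,n\}$, $\mathcal{S}(G)$ is the set of real symmetric $n\times n$ matrices $A=(a_{ij})$ such that, for all $i\neq j$, $a_{ij}\neq 0$ if and only if $i$ and $j$ are adjacent in $G$ (no restriction on the diagonal). Lists are multisets; the spectrum of a matrix is the multiset of its eigenvalues counted with multiplicity. *)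

theory Defs
  imports "Jordan_Normal_Form.Char_Poly"
begin

text \<open>
  Graphs on the vertex set \<open>{0..<n}\<close> (instead of \<open>{1..n}\<close>, to agree with the indexing of
  matrix entries) are given by their set of edges, an edge being a two-element set of vertices.
\<close>

definition complete_edges :: "nat \<Rightarrow> nat set set" where
  "complete_edges n = {{i, j} | i j. i < n \<and> j < n \<and> i \<noteq> j}"

definition graph_matrices :: "nat \<Rightarrow> nat set set \<Rightarrow> real mat set" where
  "graph_matrices n E =
    {A \<in> carrier_mat n n. transpose_mat A = A \<and>
      (\<forall>i<n. \<forall>j<n. i \<noteq> j \<longrightarrow> (A $$ (i, j) \<noteq> 0 \<longleftrightarrow> {i, j} \<in> E))}"

text \<open>
  Algebraic multiplicities are used. A real symmetric matrix has only real eigenvalues, and their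
  algebraic and geometric multiplicities coincide.
\<close>

definition spectrum_mset :: "real mat \<Rightarrow> real multiset" where
  "spectrum_mset A = proots (char_poly A)"

end

theory Submission
  imports Defs
begin

text \<open>Relabelling vertices reduces existence to the missing edge \<open>{0,1}\<close>. Three
  distinct values \<open>a < b < c\<close> of the list are realized on the path 0 - 2 - 1: diagonal
  entries \<open>x\<close>, \<open>y\<close> at its ends with \<open>a < x < b < y < c\<close> are
  prescribed, and suitable weights and a central entry exist (\<open>path_3_realization\<close>).
  The other values are added one at a time. If the last diagonal entry of \<open>M\<close> differs
  from \<open>l\<close>, rotating the direct sum of \<open>M\<close> and \<open>l\<close> in the
  last two coordinates splits the last vertex into two adjacent copies and leaves the pair 0, 1
  alone (\<open>clone_last_vertex\<close>). The next step again needs a suitable last diagonal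
  entry; as only finitely many rotations are bad, the induction in
  \<open>realization_missing_edge_01\<close> carries a finite set of forbidden values.

  For \<open>n = 3\<close> the graph is a path. A repeated eigenvalue would make the characteristic
  polynomial (t - \<alpha>)^2 (t - \<beta>), which has the sign of t - \<beta> away from \<alpha>.
  But at the end entries \<open>x < y\<close> it is positive at \<open>x\<close> and negative at
  \<open>y\<close>, the wrong order. The case \<open>x = y\<close> falls by comparing polynomials
  (\<open>path_3_no_double_root\<close>).\<close>

lemma infinite_avoiding:
  assumes "infinite S" "inj_on f S" "finite F"
  obtains x where "x \<in> S" "f x \<notin> F"
proof -
  have "infinite (f ` S)"
    using assms(1,2) finite_image_iff by blast
  then have "\<not> f ` S \<subseteq> F"
    using assms(3) finite_subset by blast
  then show thesis
    using that by blast
qed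

lemma size_eq_card_set_mset_if_count_le_1:
  assumes "\<And>x. count A x \<le> 1"
  shows "size A = card (set_mset A)"
proof -
  have "count A x = 1" if "x \<in># A" for x
    using assms[of x] that by (simp add: le_antisym Suc_le_eq)
  then show ?thesis
    by (simp add: size_multiset_overloaded_eq)
qed

section \<open>Characteristic polynomials: order three, and relabelling\<close>

lemma det_2:
  assumes A: "(A :: 'a :: comm_ring_1 mat) \<in> carrier_mat 2 2"
  shows "det A = A $$ (0,0) * A $$ (1,1) - A $$ (0,1) * A $$ (1,0)"
proof -
  have "det A = (\<Sum>j<2. A $$ (0,j) * cofactor A 0 j)"
    using laplace_expansion_row[OF A, of 0] by simp
  also have "\<dots> = A $$ (0,0) * A $$ (1,1) - A $$ (0,1) * A $$ (1,0)"
    using A by (simp add: lessThan_nat_numeral lessThan_Suc cofactor_def det_single mat_delete_def)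
  finally show ?thesis .
qed

lemma det_3:
  assumes A: "(A :: 'a :: comm_ring_1 mat) \<in> carrier_mat 3 3"
  shows "det A = A $$ (0,0) * (A $$ (1,1) * A $$ (2,2) - A $$ (1,2) * A $$ (2,1))
    - A $$ (0,1) * (A $$ (1,0) * A $$ (2,2) - A $$ (1,2) * A $$ (2,0))
    + A $$ (0,2) * (A $$ (1,0) * A $$ (2,1) - A $$ (1,1) * A $$ (2,0))"
proof -
  have "det A = (\<Sum>j<3. A $$ (0,j) * cofactor A 0 j)"
    using laplace_expansion_row[OF A, of 0] by simp
  also have "\<dots> = A $$ (0,0) * cofactor A 0 0 + A $$ (0,1) * cofactor A 0 1
      + A $$ (0,2) * cofactor A 0 2"
    by (simp add: numeral_3_eq_3 lessThan_Suc numeral_2_eq_2 algebra_simps)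
  also have "cofactor A 0 0 = A $$ (1,1) * A $$ (2,2) - A $$ (1,2) * A $$ (2,1)"
    using A unfolding cofactor_def by (subst det_2) (auto simp: mat_delete_def numeral_2_eq_2)
  also have "cofactor A 0 1 = - (A $$ (1,0) * A $$ (2,2) - A $$ (1,2) * A $$ (2,0))"
    using A unfolding cofactor_def by (subst det_2) (auto simp: mat_delete_def numeral_2_eq_2)
  also have "cofactor A 0 2 = A $$ (1,0) * A $$ (2,1) - A $$ (1,1) * A $$ (2,0)"
    using A unfolding cofactor_def by (subst det_2) (auto simp: mat_delete_def numeral_2_eq_2)
  finally show ?thesis
    by (simp add: algebra_simps)
qed

lemma poly_char_poly_symmetric_3:
  assumes A: "(A :: real mat) \<in> carrier_mat 3 3" and sym: "transpose_mat A = A"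
  shows "poly (char_poly A) t =
    (t - A $$ (0,0)) * (t - A $$ (1,1)) * (t - A $$ (2,2))
    - (A $$ (1,2))\<^sup>2 * (t - A $$ (0,0)) - (A $$ (0,2))\<^sup>2 * (t - A $$ (1,1))
    - (A $$ (0,1))\<^sup>2 * (t - A $$ (2,2)) - 2 * A $$ (0,1) * A $$ (0,2) * A $$ (1,2)"
proof -
  have "A $$ (j,i) = A $$ (i,j)" if "i < 3" "j < 3" for i j
    using that A arg_cong[OF sym, of "\<lambda>B. B $$ (i,j)"] by simp
  then have s: "A $$ (1,0) = A $$ (0,1)" "A $$ (2,0) = A $$ (0,2)" "A $$ (2,1) = A $$ (1,2)"
    by auto
  show ?thesis
    using A unfolding char_poly_def
    by (subst det_3) (auto simp: char_poly_matrix_def s s[simplified] power2_eq_square algebra_simps)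
qed

text \<open>Rows are permuted directly and columns through a transpose, so the sign of
  \<open>p\<close> enters twice and cancels.\<close>

lemma char_poly_permute:
  fixes A :: "'a :: comm_ring_1 mat"
  assumes A: "A \<in> carrier_mat n n" and p: "p permutes {0..<n}"
  shows "char_poly (mat n n (\<lambda>(i,j). A $$ (p i, p j))) = char_poly A"
proof -
  let ?C = "char_poly_matrix A"
  let ?R = "mat n n (\<lambda>(i,j). ?C $$ (p i, j))"
  have C: "?C \<in> carrier_mat n n" and R: "?R \<in> carrier_mat n n"
    using A by auto
  have pn: "p i < n" if "i < n" for i
    using permutes_in_image[OF p, of i] that by simp
  have inj: "p i = p j \<longleftrightarrow> i = j" for i j
    using permutes_inj[OF p] by (auto dest: injD)
  have "char_poly_matrix (mat n n (\<lambda>(i,j). A $$ (p i, p j)))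
      = transpose_mat (mat n n (\<lambda>(i,j). transpose_mat ?R $$ (p i, j)))"
    using A pn by (intro eq_matI) (auto simp: char_poly_matrix_def inj)
  then have "char_poly (mat n n (\<lambda>(i,j). A $$ (p i, p j)))
      = det (mat n n (\<lambda>(i,j). transpose_mat ?R $$ (p i, j)))"
    unfolding char_poly_def by (simp add: det_transpose[of _ n])
  also have "\<dots> = signof p * (signof p * det ?C)"
    using det_permute_rows[OF transpose_carrier_mat[THEN iffD2, OF R] p] det_permute_rows[OF C p]
      det_transpose[OF R] by simp
  also have "\<dots> = det ?C"
    by (simp add: sign_def)
  finally show ?thesis
    by (simp add: char_poly_def)
qed

section \<open>The zero pattern of a complete graph minus an edge\<close>

lemma complete_edges_doubleton_iff:
  assumes "i < n" "j < n"
  shows "{i, j} \<in> complete_edges n \<longleftrightarrow> i \<noteq> j"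
  using assms unfolding complete_edges_def by (auto simp: doubleton_eq_iff)

lemma graph_matrices_complete_minus_edge_iff:
  "M \<in> graph_matrices n (complete_edges n - {e}) \<longleftrightarrow>
    M \<in> carrier_mat n n \<and> transpose_mat M = M \<and>
    (\<forall>i<n. \<forall>j<n. i \<noteq> j \<longrightarrow> (M $$ (i,j) \<noteq> 0 \<longleftrightarrow> {i,j} \<noteq> e))"
  unfolding graph_matrices_def by (auto simp: complete_edges_doubleton_iff)

lemma symmetric_matD:
  assumes "transpose_mat A = A" "A \<in> carrier_mat n n" "i < n" "j < n"
  shows "A $$ (j,i) = A $$ (i,j)"
  using assms(2-) arg_cong[OF assms(1), of "\<lambda>B. B $$ (i,j)"] by simp

section \<open>Adding one vertex and one eigenvalue\<close>

text \<open>
  The last vertex is replaced by two adjacent copies of itself: the new matrix is the conjugate of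
  the direct sum of \<open>M\<close> and \<open>l\<close> by a rotation in the plane of the last two coordinates. The entry
  joining the two copies is a nonzero multiple of \<open>M $$ (m,m) - l\<close>. The freedom in the rotation
  angle lets the new last diagonal entry avoid \<open>F\<close>, in particular the next eigenvalue to be added.
\<close>

lemma clone_last_vertex:
  fixes M :: "real mat" and l :: real
  assumes M: "M \<in> graph_matrices (Suc m) (complete_edges (Suc m) - {e})"
    and e: "e \<subseteq> {0..<m}" and ne: "M $$ (m,m) \<noteq> l" and F: "finite F"
  obtains M' where "M' \<in> graph_matrices (Suc (Suc m)) (complete_edges (Suc (Suc m)) - {e})"
    "char_poly M' = char_poly M * [:-l, 1:]" "M' $$ (Suc m, Suc m) \<notin> F"
proof -
  let ?d = "M $$ (m,m)"
  have carr: "M \<in> carrier_mat (Suc m) (Suc m)" and symM: "transpose_mat M = M"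
    and nz: "\<And>i j. i < Suc m \<Longrightarrow> j < Suc m \<Longrightarrow> i \<noteq> j \<Longrightarrow> M $$ (i,j) \<noteq> 0 \<longleftrightarrow> {i,j} \<noteq> e"
    using M by (auto simp: graph_matrices_complete_minus_edge_iff)
  \<comment> \<open>This function of the cosine \<open>c\<close> is the last diagonal entry of the
    matrix constructed below.\<close>
  have "inj_on (\<lambda>c. ?d + (l - ?d) * c\<^sup>2) {0<..<1::real}"
    using ne by (auto intro!: inj_onI)
  then obtain c where c: "0 < c" "c < 1" and cF: "?d + (l - ?d) * c\<^sup>2 \<notin> F"
    using infinite_avoiding[of "{0<..<1::real}" "\<lambda>c. ?d + (l - ?d) * c\<^sup>2" F] F
    by (auto simp: infinite_Ioo)
  define s where "s = sqrt (1 - c\<^sup>2)"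
  have c2: "c\<^sup>2 < 1"
    using c by (simp add: power_less_one_iff)
  then have s: "s > 0" and s2: "s\<^sup>2 = 1 - c\<^sup>2"
    by (auto simp: s_def)
  \<comment> \<open>\<open>idx\<close> merges the two copies into the old vertex \<open>m\<close>.
    Row \<open>i\<close> of the rotation \<open>P\<close> has \<open>w i\<close> in column
    \<open>idx i\<close> and \<open>u i\<close> in the last column; on the last two coordinates
    \<open>P\<close> is ((c, -s), (s, c)).\<close>
  define idx where "idx i = min i m" for i
  define w where "w i = (if i < m then 1 else if i = m then c else s)" for i
  define u where "u i = (if i < m then 0 else if i = m then - s else c)" for i
  let ?n = "Suc (Suc m)"
  define P where "P = mat ?n ?n (\<lambda>(i,k). if k = Suc m then u i else if k = idx i then w i else 0)"
  define D where "D = four_block_mat M (0\<^sub>m (Suc m) 1) (0\<^sub>m 1 (Suc m)) (mat 1 1 (\<lambda>_. l))"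
  \<comment> \<open>The product \<open>P * D * transpose_mat P\<close>, written entrywise.\<close>
  define M' where "M' = mat ?n ?n (\<lambda>(i,j). w i * w j * M $$ (idx i, idx j) + l * u i * u j)"
  have P: "P \<in> carrier_mat ?n ?n" and D: "D \<in> carrier_mat ?n ?n" and M'c: "M' \<in> carrier_mat ?n ?n"
    using carr by (auto simp: P_def D_def M'_def)
  define B where "B = P * D"
  have B: "B \<in> carrier_mat ?n ?n"
    using P D by (simp add: B_def)
  have idx: "idx i < Suc m" for i
    by (simp add: idx_def)
  have Pl: "P $$ (i, k) = (if k = idx i then w i else 0)" if "i < ?n" "k < Suc m" for i k
    using that by (simp add: P_def)
  have Pr: "P $$ (i, Suc m) = u i" if "i < ?n" for i
    using that by (simp add: P_def)
  have PP: "P * transpose_mat P = 1\<^sub>m ?n"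
  proof (rule eq_matI)
    fix i j assume "i < dim_row (1\<^sub>m ?n :: real mat)" "j < dim_col (1\<^sub>m ?n :: real mat)"
    then have ij: "i < ?n" "j < ?n" by auto
    have "(P * transpose_mat P) $$ (i,j) = (\<Sum>k<Suc m. P $$ (i,k) * P $$ (j,k)) + u i * u j"
      using ij P by (simp add: scalar_prod_def Pr atLeast0LessThan)
    also have "(\<Sum>k<Suc m. P $$ (i,k) * P $$ (j,k))
        = (\<Sum>k<Suc m. if k = idx i then w i * (if idx i = idx j then w j else 0) else 0)"
      using ij by (intro sum.cong refl) (simp add: Pl)
    also have "\<dots> = w i * (if idx i = idx j then w j else 0)"
      using idx[of i] by (subst sum.delta) auto
    also have "\<dots> + u i * u j = (if i = j then 1 else 0)"
      using ij s2 by (auto simp: idx_def w_def u_def min_def power2_eq_square split: if_splits)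
    finally show "(P * transpose_mat P) $$ (i,j) = 1\<^sub>m ?n $$ (i,j)"
      using ij by simp
  qed (use P in auto)
  have M'_eq: "M' = B * transpose_mat P"
  proof (rule eq_matI)
    fix i j assume "i < dim_row (B * transpose_mat P)" "j < dim_col (B * transpose_mat P)"
    then have ij: "i < ?n" "j < ?n" using P B by auto
    have row: "B $$ (i,k) = (if k = Suc m then l * u i else w i * M $$ (idx i, k))"
      if k: "k < ?n" for k
    proof -
      have "B $$ (i,k) = (\<Sum>h<Suc m. P $$ (i,h) * D $$ (h,k)) + u i * D $$ (Suc m, k)"
        using ij k P D by (simp add: B_def scalar_prod_def Pr atLeast0LessThan)
      also have "(\<Sum>h<Suc m. P $$ (i,h) * D $$ (h,k))
          = (\<Sum>h<Suc m. if h = idx i then w i * D $$ (h,k) else 0)"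
        using ij by (intro sum.cong refl) (simp add: Pl)
      also have "\<dots> = w i * D $$ (idx i, k)"
        using idx[of i] by (subst sum.delta) auto
      finally show ?thesis
        using k carr idx[of i] by (auto simp: D_def)
    qed
    have "(B * transpose_mat P) $$ (i,j)
        = (\<Sum>k<Suc m. B $$ (i,k) * P $$ (j,k)) + B $$ (i, Suc m) * u j"
      using ij P B by (simp add: scalar_prod_def Pr atLeast0LessThan)
    also have "(\<Sum>k<Suc m. B $$ (i,k) * P $$ (j,k))
        = (\<Sum>k<Suc m. if k = idx j then w i * M $$ (idx i, k) * w j else 0)"
      using ij by (intro sum.cong refl) (auto simp: Pl row)
    also have "\<dots> = w i * M $$ (idx i, idx j) * w j"
      using idx[of j] by (subst sum.delta) auto
    finally show "M' $$ (i,j) = (B * transpose_mat P) $$ (i,j)"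
      using ij by (simp add: row M'_def)
  qed (use P B M'c in auto)
  have "transpose_mat P * P = 1\<^sub>m ?n"
    using mat_mult_left_right_inverse[OF P _ PP] P by simp
  then have "similar_mat M' D"
    using PP M'_eq[unfolded B_def] P D M'c by (intro similar_matI[of _ _ _ _ ?n]) auto
  then have "char_poly M' = char_poly D"
    by (rule char_poly_similar)
  also have "\<dots> = char_poly M * [:-l, 1:]"
  proof -
    have "char_poly_matrix D = four_block_mat (char_poly_matrix M) (0\<^sub>m (Suc m) 1) (0\<^sub>m 1 (Suc m))
        (mat 1 1 (\<lambda>_. [:-l, 1:]))"
      using carr by (intro eq_matI) (auto simp: char_poly_matrix_def D_def)
    then show ?thesis
      unfolding char_poly_def
      using carr by (simp add: det_four_block_mat_upper_right_zero_col[of _ "Suc m"] det_single)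
  qed
  finally have cp: "char_poly M' = char_poly M * [:-l, 1:]" .
  have M's: "M' $$ (i,j) = w i * w j * M $$ (idx i, idx j) + l * u i * u j"
    if "i < ?n" "j < ?n" for i j
    using that by (simp add: M'_def)
  have sym: "transpose_mat M' = M'"
    using symmetric_matD[OF symM carr idx idx]
    by (intro eq_matI) (auto simp: M'_def algebra_simps)
  \<comment> \<open>For \<open>i < m\<close> the term with \<open>l\<close> vanishes, and the entry
    is one of \<open>M\<close> scaled by a nonzero weight. As \<open>e\<close> lies below
    \<open>m\<close>, merging the copies does not affect whether the pair is \<open>e\<close>. The
    only other pair joins the two copies.\<close>
  have "M' $$ (i,j) \<noteq> 0 \<longleftrightarrow> {i,j} \<noteq> e" if ij: "i < j" "j < ?n" for i j
  proof (cases "i < m")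
    case True
    have "M' $$ (i,j) = w j * M $$ (i, idx j)"
      using ij True by (simp add: M's) (simp add: w_def u_def idx_def)
    moreover have "w j \<noteq> 0"
      using c s by (simp add: w_def)
    moreover have "{i, idx j} \<noteq> e \<longleftrightarrow> {i, j} \<noteq> e"
      using ij True e by (auto simp: idx_def min_def)
    ultimately show ?thesis
      using nz[of i "idx j"] True ij idx[of j] by (auto simp: idx_def)
  next
    case False
    then have ij': "i = m" "j = Suc m"
      using ij by auto
    have "M' $$ (i,j) = c * s * (?d - l)"
      using ij by (simp add: M's) (simp add: ij' w_def u_def idx_def algebra_simps)
    then show ?thesis
      using c s ne e ij' by auto
  qed
  then have pat: "M' $$ (i,j) \<noteq> 0 \<longleftrightarrow> {i,j} \<noteq> e" if "i \<noteq> j" "i < ?n" "j < ?n" for i j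
    using that symmetric_matD[OF sym M'c, of i j] by (metis insert_commute linorder_neqE_nat)
  have "M' $$ (Suc m, Suc m) = s\<^sup>2 * ?d + l * c\<^sup>2"
    by (simp add: M's) (simp add: w_def u_def idx_def power2_eq_square)
  also have "\<dots> = ?d + (l - ?d) * c\<^sup>2"
    unfolding s2 by (simp add: algebra_simps)
  finally have "M' $$ (Suc m, Suc m) = ?d + (l - ?d) * c\<^sup>2" .
  then have "M' $$ (Suc m, Suc m) \<notin> F"
    using cF by simp
  with cp sym pat M'c show thesis
    by (intro that[of M']) (auto simp: graph_matrices_complete_minus_edge_iff)
qed

section \<open>Existence for three vertices and for every larger number\<close>

text \<open>
  By partial fractions the weights of the path are determined by the values of the characteristic
  polynomial at the diagonal entries \<open>x\<close> and \<open>y\<close> of its ends, and they are positive when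
  \<open>a < x < b < y < c\<close>.
\<close>

lemma path_3_realization:
  fixes a b c :: real
  assumes ab: "a < b" and bc: "b < c" and F: "finite F"
  obtains M where "M \<in> graph_matrices 3 (complete_edges 3 - {{0,1}})"
    "char_poly M = [:-a, 1:] * [:-b, 1:] * [:-c, 1:]" "M $$ (2,2) \<notin> F"
proof -
  define x where "x = (a + b) / 2"
  have x: "a < x" "x < b"
    using ab by (auto simp: x_def)
  \<comment> \<open>\<open>x\<close> is fixed, while \<open>y\<close> stays free so that the central
    entry, forced by the trace to be \<open>a + b + c - x - y\<close>, can avoid
    \<open>F\<close>.\<close>
  have "inj_on (\<lambda>y. a + b + c - x - y) {b<..<c}"
    by (auto intro!: inj_onI)
  then obtain y where y: "b < y" "y < c" and yF: "a + b + c - x - y \<notin> F"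
    using infinite_avoiding[of "{b<..<c}" "\<lambda>y. a + b + c - x - y" F] F bc
    by (auto simp: infinite_Ioo)
  define d where "d = a + b + c - x - y"
  define p2 where "p2 = (x - a) * (b - x) * (c - x) / (y - x)"
  define q2 where "q2 = (y - a) * (y - b) * (c - y) / (y - x)"
  have yx: "y - x > 0"
    using x y by simp
  have p2: "p2 > 0" and q2: "q2 > 0"
    using x y by (auto simp: p2_def q2_def)
  define M where "M = mat_of_rows_list 3 [[x, 0, sqrt p2], [0, y, sqrt q2], [sqrt p2, sqrt q2, d]]"
  have M: "M \<in> carrier_mat 3 3"
    by (auto simp: M_def mat_of_rows_list_def)
  have ent: "M $$ (0,0) = x" "M $$ (0,1) = 0" "M $$ (0,2) = sqrt p2"
      "M $$ (1,0) = 0" "M $$ (1,1) = y" "M $$ (1,2) = sqrt q2"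
      "M $$ (2,0) = sqrt p2" "M $$ (2,1) = sqrt q2" "M $$ (2,2) = d"
    by (auto simp: M_def mat_of_rows_list_def)
  have less3: "i < 3 \<longleftrightarrow> i = 0 \<or> i = 1 \<or> i = 2" for i :: nat
    by auto
  have sym: "transpose_mat M = M"
    using M by (intro eq_matI) (auto simp: less3 ent ent[simplified])
  have "poly (char_poly M) t = poly ([:-a, 1:] * [:-b, 1:] * [:-c, 1:]) t" for t
  proof -
    have wts: "(y - x) * p2 = (x - a) * (b - x) * (c - x)" "(y - x) * q2 = (y - a) * (y - b) * (c - y)"
      using yx by (auto simp: p2_def q2_def)
    \<comment> \<open>Multiplying by \<open>y - x\<close> clears the denominators of
      \<open>p2\<close> and \<open>q2\<close>, leaving a polynomial identity.\<close>
    have "(y - x) * ((t - x) * (t - y) * (t - d) - q2 * (t - x) - p2 * (t - y))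
        = (y - x) * (t - x) * (t - y) * (t - d) - (y - x) * q2 * (t - x) - (y - x) * p2 * (t - y)"
      by (simp add: algebra_simps)
    also have "\<dots> = (y - x) * ((t - a) * (t - b) * (t - c))"
      unfolding wts by (simp add: d_def algebra_simps)
    finally have "(y - x) * ((t - x) * (t - y) * (t - d) - q2 * (t - x) - p2 * (t - y))
        = (y - x) * ((t - a) * (t - b) * (t - c))" .
    then have "(t - x) * (t - y) * (t - d) - q2 * (t - x) - p2 * (t - y) = (t - a) * (t - b) * (t - c)"
      using yx by simp
    then show ?thesis
      using p2 q2 by (simp add: poly_char_poly_symmetric_3[OF M sym] ent ent[simplified] algebra_simps)
  qed
  then have "char_poly M = [:-a, 1:] * [:-b, 1:] * [:-c, 1:]"
    by (simp add: poly_eq_poly_eq_iff[symmetric] fun_eq_iff)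
  moreover have "M \<in> graph_matrices 3 (complete_edges 3 - {{0,1}})"
    using M sym p2 q2
    by (auto simp: graph_matrices_complete_minus_edge_iff less3 ent ent[simplified] doubleton_eq_iff)
  ultimately show thesis
    using that yF by (simp add: ent d_def)
qed

text \<open>The set \<open>F\<close> strengthens the induction: it must be arbitrary so that the
  hypothesis can exclude the eigenvalue that is added next.\<close>

lemma realization_missing_edge_01:
  fixes a b c :: real
  assumes "a < b" "b < c" "finite F"
  shows "\<exists>M. M \<in> graph_matrices (size N + 3) (complete_edges (size N + 3) - {{0,1}}) \<and>
    spectrum_mset M = {#a, b, c#} + N \<and> M $$ (size N + 2, size N + 2) \<notin> F"
  using assms(3)
proof (induction N arbitrary: F)
  case empty
  obtain M where M: "M \<in> graph_matrices 3 (complete_edges 3 - {{0,1}})"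
    "char_poly M = [:-a, 1:] * [:-b, 1:] * [:-c, 1:]" "M $$ (2,2) \<notin> F"
    using path_3_realization[OF assms(1,2) empty] .
  have "spectrum_mset M = {#a, b, c#}"
    unfolding spectrum_mset_def M(2) by (subst proots_mult | simp)+
  with M show ?case
    by (auto simp: numeral_2_eq_2)
next
  case (add l N)
  define m where "m = size N + 2"
  have m: "size N + 3 = Suc m" "size (add_mset l N) + 3 = Suc (Suc m)"
    "size N + 2 = m" "size (add_mset l N) + 2 = Suc m"
    by (auto simp: m_def)
  \<comment> \<open>Forbidding \<open>l\<close> as last diagonal entry is exactly what cloning
    requires.\<close>
  obtain M where M: "M \<in> graph_matrices (Suc m) (complete_edges (Suc m) - {{0,1}})"
    "spectrum_mset M = {#a, b, c#} + N" "M $$ (m,m) \<noteq> l"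
    using add.IH[of "{l}"] unfolding m by auto
  obtain M' where M': "M' \<in> graph_matrices (Suc (Suc m)) (complete_edges (Suc (Suc m)) - {{0,1}})"
    "char_poly M' = char_poly M * [:-l, 1:]" "M' $$ (Suc m, Suc m) \<notin> F"
    using clone_last_vertex[OF M(1) _ M(3) add.prems] by (auto simp: m_def)
  have "char_poly M \<noteq> 0"
    using M(1) degree_monic_char_poly[of M "Suc m"] by (auto simp: graph_matrices_def)
  then have "spectrum_mset M' = spectrum_mset M + {#l#}"
    unfolding spectrum_mset_def M'(2) by (subst proots_mult) auto
  with M M' show ?case
    unfolding m by auto
qed

lemma realization:
  fixes \<Lambda> :: "real multiset"
  assumes e: "e \<in> complete_edges n" and size: "size \<Lambda> = n" and card: "card (set_mset \<Lambda>) \<ge> 3"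
  shows "\<exists>M \<in> graph_matrices n (complete_edges n - {e}). spectrum_mset M = \<Lambda>"
proof -
  let ?S = "set_mset \<Lambda>"
  define a where "a = Min ?S"
  define c where "c = Max ?S"
  have ne: "?S \<noteq> {}"
    using card by auto
  have "card {a, c} \<le> 2"
    by (simp add: card_insert_if)
  then have "\<not> ?S \<subseteq> {a, c}"
    using card card_mono[of "{a, c}" ?S] by auto
  then obtain b where b: "b \<in> ?S" "b \<noteq> a" "b \<noteq> c"
    by auto
  have ac: "a \<in> ?S" "c \<in> ?S" "a \<le> b" "b \<le> c"
    using ne b by (auto simp: a_def c_def)
  have ord: "a < b" "b < c"
    using b ac by auto
  have "{#a, b, c#} \<subseteq># \<Lambda>"
    using ac b ord by (intro mset_subset_eqI) (auto simp: Suc_le_eq)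
  then obtain N where N: "\<Lambda> = {#a, b, c#} + N"
    using mset_subset_eq_exists_conv by blast
  have n: "size N + 3 = n"
    using size N by simp
  obtain M where M: "M \<in> graph_matrices n (complete_edges n - {{0,1}})" "spectrum_mset M = \<Lambda>"
    using realization_missing_edge_01[OF ord, of "{}" N] unfolding n N by auto
  from M(1) have carr: "M \<in> carrier_mat n n" and sym: "transpose_mat M = M"
    and nz: "\<And>i j. i < n \<Longrightarrow> j < n \<Longrightarrow> i \<noteq> j \<Longrightarrow> M $$ (i,j) \<noteq> 0 \<longleftrightarrow> {i,j} \<noteq> {0,1}"
    by (auto simp: graph_matrices_complete_minus_edge_iff)
  obtain i j where ij: "e = {i, j}" "i < n" "j < n" "i \<noteq> j"
    using e unfolding complete_edges_def by auto
  \<comment> \<open>The first transposition sends \<open>i\<close> to 0; the second sends the image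
    of \<open>j\<close> to 1 and fixes 0, since that image is not 0.\<close>
  define p where "p = transpose 1 (transpose 0 i j) \<circ> transpose 0 i"
  have t: "transpose 0 i j < n" "transpose 0 i j \<noteq> 0"
    using ij by (auto simp: transpose_def)
  have p: "p permutes {0..<n}"
    unfolding p_def using ij t n
    by (intro permutes_compose permutes_swap_id) auto
  have pij: "p i = 0" "p j = 1"
    using t(2) by (auto simp: p_def transpose_def)
  have inj: "p k = p l \<longleftrightarrow> k = l" for k l
    using permutes_inj[OF p] by (auto dest: injD)
  have pn: "p k < n" if "k < n" for k
    using permutes_in_image[OF p, of k] that by simp
  have edge: "{p k, p l} = {0,1} \<longleftrightarrow> {k, l} = e" for k l
    unfolding ij(1) pij[symmetric] doubleton_eq_iff inj ..
  let ?M = "mat n n (\<lambda>(i,j). M $$ (p i, p j))"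
  have "transpose_mat ?M = ?M"
    using symmetric_matD[OF sym carr pn pn] by (intro eq_matI) simp_all
  moreover have "?M $$ (k,l) \<noteq> 0 \<longleftrightarrow> {k,l} \<noteq> e" if "k < n" "l < n" "k \<noteq> l" for k l
    using nz[of "p k" "p l", unfolded edge] pn that by (simp add: inj)
  ultimately have "?M \<in> graph_matrices n (complete_edges n - {e})"
    unfolding graph_matrices_complete_minus_edge_iff by (intro conjI allI impI) simp_all
  moreover have "spectrum_mset ?M = \<Lambda>"
    using M(2) char_poly_permute[OF carr p] by (simp add: spectrum_mset_def)
  ultimately show ?thesis
    by blast
qed

section \<open>Necessity of distinct eigenvalues on the path\<close>

text \<open>
  If \<open>x \<noteq> y\<close>, comparing signs at \<open>x\<close> and \<open>y\<close> puts \<open>\<beta>\<close> strictly below the smaller and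
  strictly above the larger of the two.
\<close>

lemma path_3_no_double_root:
  fixes x y d p q \<alpha> \<beta> :: real
  assumes p: "p \<noteq> 0" and q: "q \<noteq> 0"
    and eq: "\<And>t. (t - d) * (t - x) * (t - y) - p\<^sup>2 * (t - y) - q\<^sup>2 * (t - x)
      = (t - \<alpha>)\<^sup>2 * (t - \<beta>)"
  shows False
proof -
  have p2: "p\<^sup>2 > 0" and q2: "q\<^sup>2 > 0"
    using p q by auto
  have ex: "p\<^sup>2 * (y - x) = (x - \<alpha>)\<^sup>2 * (x - \<beta>)"
    using eq[of x] by (simp add: algebra_simps)
  have ey: "q\<^sup>2 * (x - y) = (y - \<alpha>)\<^sup>2 * (y - \<beta>)"
    using eq[of y] by (simp add: algebra_simps)
  consider "x < y" | "y < x" | "x = y"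
    by linarith
  then show False
  proof cases
    case 1
    then have "(x - \<alpha>)\<^sup>2 * (x - \<beta>) > 0" "(y - \<alpha>)\<^sup>2 * (y - \<beta>) < 0"
      using ex ey p2 q2 by (auto simp flip: ex ey simp: mult_pos_neg)
    then have "x > \<beta>" "y < \<beta>"
      by (auto simp: zero_less_mult_iff mult_less_0_iff)
    with 1 show False by simp
  next
    case 2
    then have "(x - \<alpha>)\<^sup>2 * (x - \<beta>) < 0" "(y - \<alpha>)\<^sup>2 * (y - \<beta>) > 0"
      using ex ey p2 q2 by (auto simp flip: ex ey simp: mult_pos_neg)
    then have "x < \<beta>" "y > \<beta>"
      by (auto simp: zero_less_mult_iff mult_less_0_iff)
    with 2 show False by simp
  next
    case 3
    let ?r = "p\<^sup>2 + q\<^sup>2"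
    \<comment> \<open>Shifting by \<open>x\<close> exposes the factor \<open>s\<close> on the left.
      So \<open>x\<close> is a root on the right, and one factor \<open>s\<close> cancels for
      \<open>s \<noteq> 0\<close>. Three nonzero values of \<open>s\<close> then suffice to compare
      the quadratics, whose constant terms contradict \<open>?r > 0\<close>.\<close>
    have eq': "s * (s * (s + x - d) - ?r) = (s + x - \<alpha>)\<^sup>2 * (s + x - \<beta>)" for s
      using eq[of "s + x"] 3 by (simp add: algebra_simps power2_eq_square)
    consider "x = \<alpha>" | "x = \<beta>"
      using ex 3 by auto
    then show False
    proof cases
      case 1
      have e1: "s * (s + x - d) - ?r = s * (s + x - \<beta>)" if "s \<noteq> 0" for s
        using eq'[of s] 1 that by (simp add: power2_eq_square)
      show False
        using e1[of 1] e1[of "-1"] e1[of 2] p2 q2 by (simp add: algebra_simps)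
    next
      case 2
      have e1: "s * (s + x - d) - ?r = (s + x - \<alpha>)\<^sup>2" if "s \<noteq> 0" for s
        using eq'[of s] 2 that by simp
      have "- ?r = (x - \<alpha>)\<^sup>2"
        using e1[of 1] e1[of "-1"] e1[of 2] by (simp add: algebra_simps power2_eq_square)
      then show False
        using p2 q2 zero_le_power2[of "x - \<alpha>"] by linarith
    qed
  qed
qed

lemma path_3_distinct_eigenvalues:
  fixes M :: "real mat"
  assumes e: "e \<in> complete_edges 3" and M: "M \<in> graph_matrices 3 (complete_edges 3 - {e})"
    and size: "size (spectrum_mset M) = 3"
  shows "card (set_mset (spectrum_mset M)) = 3"
proof (rule ccontr)
  let ?\<Lambda> = "spectrum_mset M"
  from M have carr: "M \<in> carrier_mat 3 3" and sym: "transpose_mat M = M"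
    and nz: "\<And>i j. i < 3 \<Longrightarrow> j < 3 \<Longrightarrow> i \<noteq> j \<Longrightarrow> M $$ (i,j) \<noteq> 0 \<longleftrightarrow> {i,j} \<noteq> e"
    by (auto simp: graph_matrices_complete_minus_edge_iff)
  have deg: "degree (char_poly M) = 3" and monic: "lead_coeff (char_poly M) = 1"
    using degree_monic_char_poly[OF carr] by auto
  assume "card (set_mset ?\<Lambda>) \<noteq> 3"
  \<comment> \<open>Three eigenvalues with multiplicity, not all distinct, force a repeated
    one.\<close>
  then obtain \<alpha> where "count ?\<Lambda> \<alpha> \<ge> 2"
    using size size_eq_card_set_mset_if_count_le_1[of ?\<Lambda>] by (metis Suc_1 not_less_eq_eq)
  moreover have "char_poly M \<noteq> 0"
    using monic by auto
  ultimately have "order \<alpha> (char_poly M) \<ge> 2"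
    by (simp add: spectrum_mset_def)
  then have "[:-\<alpha>, 1:] ^ 2 dvd char_poly M"
    using order_divides by blast
  then obtain r where r: "char_poly M = [:-\<alpha>, 1:] ^ 2 * r"
    by (elim dvdE)
  have "r \<noteq> 0"
    using r deg by auto
  then have "degree r = 1"
    using deg by (simp add: r degree_mult_eq degree_power_eq)
  moreover have "lead_coeff r = 1"
    using monic by (simp add: r lead_coeff_mult lead_coeff_power)
  ultimately obtain \<beta> where "r = [:-\<beta>, 1:]"
    by (metis degree1_coeffs coeff_pCons_Suc coeff_pCons_0 One_nat_def minus_minus)
  then have pr: "poly (char_poly M) t = (t - \<alpha>)\<^sup>2 * (t - \<beta>)" for t
    by (simp add: r power2_eq_square algebra_simps)
  note cp = poly_char_poly_symmetric_3[OF carr sym, unfolded pr]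
  note no = path_3_no_double_root[where \<alpha> = \<alpha> and \<beta> = \<beta>]
  have nz': "M $$ (0,1) \<noteq> 0 \<longleftrightarrow> {0,1} \<noteq> e" "M $$ (0,2) \<noteq> 0 \<longleftrightarrow> {0,2} \<noteq> e"
    "M $$ (1,2) \<noteq> 0 \<longleftrightarrow> {1,2} \<noteq> e"
    using nz[of 0 1] nz[of 0 2] nz[of 1 2] by simp_all
  obtain i j where ij: "e = {i, j}" "i < 3" "j < 3" "i \<noteq> j"
    using e unfolding complete_edges_def by blast
  then have "i \<in> {0,1,2}" "j \<in> {0,1,2}"
    by auto
  \<comment> \<open>The ends of the path are the elements of \<open>e\<close>. The remaining vertex
    is its centre, and its diagonal entry plays the role of \<open>d\<close> in
    \<open>path_3_no_double_root\<close>.\<close>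
  with ij consider "e = {0,1}" | "e = {0,2}" | "e = {1,2}"
    by (elim insertE emptyE) (simp_all add: insert_commute)
  then show False
  proof cases
    case 1
    then have z: "M $$ (0,1) = 0" "M $$ (0,2) \<noteq> 0" "M $$ (1,2) \<noteq> 0"
      using nz' by (auto simp: doubleton_eq_iff)
    show False
    proof (rule no[OF z(2,3), of "M $$ (2,2)" "M $$ (0,0)" "M $$ (1,1)"])
      fix t
      show "(t - M $$ (2,2)) * (t - M $$ (0,0)) * (t - M $$ (1,1)) - (M $$ (0,2))\<^sup>2 * (t - M $$ (1,1))
          - (M $$ (1,2))\<^sup>2 * (t - M $$ (0,0)) = (t - \<alpha>)\<^sup>2 * (t - \<beta>)"
        using cp[of t] unfolding z by (simp add: algebra_simps)
    qed
  next
    case 2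
    then have z: "M $$ (0,2) = 0" "M $$ (0,1) \<noteq> 0" "M $$ (1,2) \<noteq> 0"
      using nz' by (auto simp: doubleton_eq_iff)
    show False
    proof (rule no[OF z(2,3), of "M $$ (1,1)" "M $$ (0,0)" "M $$ (2,2)"])
      fix t
      show "(t - M $$ (1,1)) * (t - M $$ (0,0)) * (t - M $$ (2,2)) - (M $$ (0,1))\<^sup>2 * (t - M $$ (2,2))
          - (M $$ (1,2))\<^sup>2 * (t - M $$ (0,0)) = (t - \<alpha>)\<^sup>2 * (t - \<beta>)"
        using cp[of t] unfolding z by (simp add: algebra_simps)
    qed
  next
    case 3
    then have z: "M $$ (1,2) = 0" "M $$ (0,1) \<noteq> 0" "M $$ (0,2) \<noteq> 0"
      using nz' by (auto simp: doubleton_eq_iff)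
    show False
    proof (rule no[OF z(2,3), of "M $$ (0,0)" "M $$ (1,1)" "M $$ (2,2)"])
      fix t
      show "(t - M $$ (0,0)) * (t - M $$ (1,1)) * (t - M $$ (2,2)) - (M $$ (0,1))\<^sup>2 * (t - M $$ (2,2))
          - (M $$ (0,2))\<^sup>2 * (t - M $$ (1,1)) = (t - \<alpha>)\<^sup>2 * (t - \<beta>)"
        using cp[of t] unfolding z by (simp add: algebra_simps)
    qed
  qed
qed

theorem corollary3p1:
  fixes n :: nat and e :: "nat set"
  assumes "e \<in> complete_edges n"
  shows "(\<forall>\<Lambda> :: real multiset. size \<Lambda> = n \<and> card (set_mset \<Lambda>) \<ge> 3 \<longrightarrow>
            (\<exists>M \<in> graph_matrices n (complete_edges n - {e}). spectrum_mset M = \<Lambda>)) \<and>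
         (n = 3 \<longrightarrow>
            (\<forall>\<Lambda> :: real multiset. size \<Lambda> = 3 \<longrightarrow>
              ((\<exists>M \<in> graph_matrices n (complete_edges n - {e}). spectrum_mset M = \<Lambda>) \<longleftrightarrow>
               card (set_mset \<Lambda>) = 3)))"
proof (intro conjI impI allI)
  fix \<Lambda> :: "real multiset"
  assume "size \<Lambda> = n \<and> card (set_mset \<Lambda>) \<ge> 3"
  then show "\<exists>M \<in> graph_matrices n (complete_edges n - {e}). spectrum_mset M = \<Lambda>"
    using realization[OF assms] by blast
next
  fix \<Lambda> :: "real multiset"
  assume "n = 3" and "size \<Lambda> = 3"
  then show "(\<exists>M \<in> graph_matrices n (complete_edges n - {e}). spectrum_mset M = \<Lambda>) \<longleftrightarrow>
      card (set_mset \<Lambda>) = 3"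
    using realization[OF assms, of \<Lambda>] path_3_distinct_eigenvalues assms by auto
qed

end
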